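(* Let $M$ and $N$ be nonempty closed bounded convex subsets of a Hilbert space $X$. Let $F:M\cup N\to M\cup N$ satisfy (1) $F(M)\subseteq N$ and $F(N)\subseteq M$; and (2) $\|Fw-Fz\|\le\|w-z\|$ for all $w\in M$, $z\in N$. Let $\epsilon\in(0,1/2)$, let $\eta_n,\delta_n\in(\epsilon,1-\epsilon)$ for $n=0,1,2,\dots$, let $w_0\in M$, and define $$z_n=(1-\delta_n)w_n+\delta_nP_MFw_n,\qquad w_{n+1}=P^n\big((1-\eta_n)w_n+\eta_nP_MFz_n\big),\qquad n=0,1,2,\dots.$$ If $F$ maps $M$ into a compact subset of $N$ and $\|w_n-P_MFz_n\|\to0$, then $\{w_n\}$ converges (in norm) to some $w\in M_0$ such that $\|w-Fw\|=d(M,N)$.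
   Context: For subsets $M,N$ of a Hilbert space $X$: $d(M,N)=\inf\{\|w-z\|: w\in M, z\in N\}$ and $M_0=\{w\in M:\|w-z'\|=d(M,N)\text{ for some } z'\in N\}$. For a nonempty closed convex subset $A$ of $X$, $P_A:X\to A$ denotes the metric (nearest point) projection. $P:X\to M$ is defined by $P(w)=P_M(P_N(w))$, and $P^n$ is its $n$-fold iterate ($P^0$ is the identity). The map $F$ is not assumed to be continuous. *)

theory Defs
  imports "HOL-Analysis.Analysis"
begin

text \<open>
  Hilbert spaces are rendered by the sort \<open>{real_inner, complete_space}\<close>; a complex Hilbert space
  is an instance via the real part of its inner product, which has the same norm.
  The distance $d(M,N)$ is \<^const>\<open>setdist\<close>, which is the infimum of the pairwise distances for
  nonempty sets.
\<close>

text \<open>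
  The library's \<^const>\<open>closest_point\<close> requires the class \<^class>\<open>heine_borel\<close>, i.e. finite dimension
  in effect. In a Hilbert space the nearest point below exists uniquely whenever \<open>A\<close> is nonempty,
  closed and convex; it is unspecified otherwise.
\<close>
definition metric_proj :: "'a::{real_inner, complete_space} set \<Rightarrow> 'a \<Rightarrow> 'a" where
  "metric_proj A x = (THE p. p \<in> A \<and> (\<forall>y\<in>A. norm (x - p) \<le> norm (x - y)))"

definition alt_proj ::
  "'a::{real_inner, complete_space} set \<Rightarrow> 'a set \<Rightarrow> 'a \<Rightarrow> 'a" where
  "alt_proj M N x = metric_proj M (metric_proj N x)"

text \<open>The set $M_0$ of points of \<open>M\<close> at which the distance to \<open>N\<close> is attained.\<close>
definition proximal_part ::
  "'a::{real_inner, complete_space} set \<Rightarrow> 'a set \<Rightarrow> 'a set" where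
  "proximal_part M N = {w \<in> M. \<exists>z\<in>N. norm (w - z) = setdist M N}"

end

theory Submission
  imports Defs
begin

text \<open>
  Write \<open>d\<close> for the distance of \<open>M\<close> and \<open>N\<close>. A pair \<open>p \<in> M\<close>, \<open>q \<in> N\<close> with
  \<open>\<parallel>p - q\<parallel> = d\<close> is called proximal; all proximal pairs have the same displacement \<open>p - q\<close>,
  and \<open>F\<close> sends proximal pairs to proximal pairs with the roles of \<open>M\<close> and \<open>N\<close> exchanged.
  Three observations carry the proof.

  \<^item> \<^emph>\<open>Measuring across the gap.\<close> Because \<open>F\<close> contracts only distances between a point of \<open>M\<close>
    and a point of \<open>N\<close>, the distance of the iterates to a point \<open>p \<in> M\<close> need not decrease. The
    distance to the partner \<open>q \<in> N\<close> of \<open>p\<close> does behave well: the inequality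
    \<open>\<parallel>P\<^sub>M u - q\<parallel>\<^sup>2 + \<parallel>(P\<^sub>M u - u) - (p - q)\<parallel>\<^sup>2 \<le> \<parallel>u - p\<parallel>\<^sup>2\<close> for \<open>u \<in> N\<close>
    (\<open>metric_proj_across_gap\<close>) shows that projecting to the other side does not increase it. Hence
    \<open>\<parallel>w\<^sub>n - q\<parallel>\<close> is decreasing as soon as \<open>p = F q\<close>. Moreover, if it tends to \<open>d\<close> along a
    subsequence, then it tends to \<open>d\<close>, and this forces \<open>w\<^sub>n \<longlonglongrightarrow> p\<close>
    (\<open>tendsto_proximal_partner\<close>).

  \<^item> \<^emph>\<open>Alternating projections close the gap uniformly.\<close> Summing the square terms of the same
    inequality along the orbit of \<open>P = P\<^sub>M P\<^sub>N\<close> bounds \<open>dist(P\<^sup>n y, N) - d\<close> by a multiple of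
    \<open>1 / sqrt n\<close>, uniformly for \<open>y\<close> in the bounded set \<open>M\<close> (\<open>alt_proj_gap_rate\<close>). Therefore
    \<open>dist(w\<^sub>n, N) \<longlonglongrightarrow> d\<close> and every limit point of \<open>w\<^sub>n\<close> belongs to a proximal pair.

  \<^item> \<^emph>\<open>\<open>F\<close> is regular where it matters.\<close> Although \<open>F\<close> may be discontinuous elsewhere, it is
    continuous relative to \<open>M\<close> at each \<open>p\<close> of a proximal pair \<open>(p, q)\<close>: if \<open>x\<^sub>n \<longlonglongrightarrow> p\<close> then
    \<open>\<parallel>F x\<^sub>n - F q\<parallel> \<le> \<parallel>x\<^sub>n - q\<parallel> \<longlonglongrightarrow> d\<close>, so \<open>F x\<^sub>n\<close> must approach the partner \<open>F p\<close>
    of \<open>F q\<close>. On first components of proximal pairs, \<open>p \<mapsto> F q\<close> is nonexpansive by the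
    parallelogram law.

  Compactness of the closure of \<open>F(M)\<close> provides proximal pairs and a subsequence along which
  \<open>F z\<^sub>n\<close> and \<open>\<delta>\<^sub>n\<close>, hence \<open>P\<^sub>M F z\<^sub>n\<close> and \<open>w\<^sub>n\<close>, converge. The limit \<open>p\<close> of the
  \<open>w\<^sub>n\<close> has a partner \<open>q\<close>, and the \<open>z\<^sub>n\<close> converge to \<open>\<zeta> = (1 - \<delta>) p + \<delta> F q\<close> for some
  \<open>\<delta> < 1\<close>. The hypothesis that \<open>w\<^sub>n - P\<^sub>M F z\<^sub>n\<close> vanishes says that \<open>p\<close> is the image of
  \<open>\<zeta>\<close> under the nonexpansive map, so \<open>\<parallel>p - F q\<parallel> \<le> \<parallel>\<zeta> - p\<parallel> = \<delta> \<parallel>p - F q\<parallel>\<close> and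
  \<open>p = F q\<close>. Monotonicity of \<open>\<parallel>w\<^sub>n - q\<parallel>\<close> turns subsequential convergence into convergence.
\<close>

section \<open>The metric projection in a Hilbert space\<close>

text \<open>
  The midpoint of \<open>a\<close> and \<open>b\<close> is also at distance at least \<open>D\<close> from \<open>x\<close>, so the parallelogram
  law leaves little room for \<open>a - b\<close> when \<open>a\<close> and \<open>b\<close> are nearly nearest.
\<close>

lemma nearly_nearest_points_close:
  fixes x :: "'a::real_inner"
  assumes "convex A" "a \<in> A" "b \<in> A" "0 \<le> D"
    and far: "\<And>y. y \<in> A \<Longrightarrow> D \<le> norm (x - y)"
  shows "(norm (a - b))\<^sup>2 \<le> 2 * (norm (x - a))\<^sup>2 + 2 * (norm (x - b))\<^sup>2 - 4 * D\<^sup>2"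
proof -
  define c where "c = (1/2) *\<^sub>R a + (1/2) *\<^sub>R b"
  have "c \<in> A"
    unfolding c_def using assms(1-3) by (intro convexD) auto
  then have "D\<^sup>2 \<le> (norm (x - c))\<^sup>2"
    using far \<open>0 \<le> D\<close> by (intro power_mono) auto
  moreover have "4 * (norm (x - c))\<^sup>2 + (norm (a - b))\<^sup>2 = 2 * (norm (x - a))\<^sup>2 + 2 * (norm (x - b))\<^sup>2"
    unfolding c_def power2_norm_eq_inner
    by (simp add: inner_diff_left inner_diff_right inner_add_left inner_add_right inner_commute
        field_simps)
  ultimately show ?thesis
    by linarith
qed

lemma nearest_point_exists:
  fixes A :: "'a::{real_inner, complete_space} set"
  assumes "A \<noteq> {}" "closed A" "convex A"
  shows "\<exists>p\<in>A. \<forall>y\<in>A. norm (x - p) \<le> norm (x - y)"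
proof -
  define D where "D = infdist x A"
  have far: "D \<le> norm (x - y)" if "y \<in> A" for y
    using infdist_le[OF that, of x] by (simp add: D_def dist_norm)
  have "0 \<le> D"
    by (simp add: D_def infdist_nonneg)
  have "\<exists>y\<in>A. norm (x - y) < D + 1 / real (Suc n)" for n
    using cInf_lessD[of "dist x ` A" "D + 1 / real (Suc n)"] \<open>A \<noteq> {}\<close>
    by (auto simp: D_def infdist_notempty dist_norm)
  then obtain y where y: "\<And>n. y n \<in> A" "\<And>n. norm (x - y n) < D + 1 / real (Suc n)"
    by metis
  have lim: "(\<lambda>n. norm (x - y n)) \<longlonglongrightarrow> D"
  proof (rule tendsto_sandwich[of "\<lambda>_. D"])
    show "\<forall>\<^sub>F n in sequentially. norm (x - y n) \<le> D + 1 / real (Suc n)"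
      using y(2) by (intro always_eventually allI less_imp_le)
    show "(\<lambda>n. D + 1 / real (Suc n)) \<longlonglongrightarrow> D"
      using tendsto_add[OF tendsto_const LIMSEQ_inverse_real_of_nat, of D]
      by (simp add: inverse_eq_divide)
  qed (use y far in auto)
  have "Cauchy y"
  proof (rule metric_CauchyI)
    fix e :: real assume "0 < e"
    have "(\<lambda>n. (norm (x - y n))\<^sup>2 - D\<^sup>2) \<longlonglongrightarrow> D\<^sup>2 - D\<^sup>2"
      by (intro tendsto_intros lim)
    then have "\<forall>\<^sub>F n in sequentially. (norm (x - y n))\<^sup>2 - D\<^sup>2 < e\<^sup>2 / 4"
      using \<open>0 < e\<close> by (intro order_tendstoD(2)[of _ 0]) auto
    then obtain n0 where n0: "\<And>n. n \<ge> n0 \<Longrightarrow> (norm (x - y n))\<^sup>2 - D\<^sup>2 < e\<^sup>2 / 4"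
      by (auto simp: eventually_sequentially)
    have "dist (y m) (y n) < e" if "m \<ge> n0" "n \<ge> n0" for m n
    proof -
      have "(norm (y m - y n))\<^sup>2 < e\<^sup>2"
        using nearly_nearest_points_close[OF \<open>convex A\<close> y(1)[of m] y(1)[of n] \<open>0 \<le> D\<close> far]
          n0[OF that(1)] n0[OF that(2)] by fastforce
      then show ?thesis
        using \<open>0 < e\<close> by (simp add: dist_norm power2_less_imp_less)
    qed
    then show "\<exists>n0. \<forall>m\<ge>n0. \<forall>n\<ge>n0. dist (y m) (y n) < e"
      by blast
  qed
  then obtain p where p: "y \<longlonglongrightarrow> p"
    using Cauchy_convergent_iff convergent_def by blast
  have "p \<in> A"
    using closed_sequentially[OF \<open>closed A\<close>] y(1) p by blast
  moreover have "norm (x - p) = D"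
    by (rule LIMSEQ_unique[OF _ lim]) (intro tendsto_intros p)
  ultimately show ?thesis
    using far by auto
qed

locale closed_convex =
  fixes A :: "'a::{real_inner, complete_space} set"
  assumes nonempty: "A \<noteq> {}" and closed: "closed A" and convex: "convex A"
begin

lemma metric_proj_eqI:
  assumes "p \<in> A" "\<And>y. y \<in> A \<Longrightarrow> norm (x - p) \<le> norm (x - y)"
  shows "metric_proj A x = p"
  unfolding metric_proj_def
proof (rule the_equality)
  fix p' assume "p' \<in> A \<and> (\<forall>y\<in>A. norm (x - p') \<le> norm (x - y))"
  then show "p' = p"
    using any_closest_point_unique[OF convex closed, of p' p x] assms by (auto simp: dist_norm)
qed (use assms in auto)

lemma metric_proj_nearest:
  "metric_proj A x \<in> A" "y \<in> A \<Longrightarrow> norm (x - metric_proj A x) \<le> norm (x - y)"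
proof -
  obtain p where "p \<in> A" "\<forall>y\<in>A. norm (x - p) \<le> norm (x - y)"
    using nearest_point_exists[OF nonempty closed convex] by blast
  then show "metric_proj A x \<in> A" "y \<in> A \<Longrightarrow> norm (x - metric_proj A x) \<le> norm (x - y)"
    using metric_proj_eqI[of p x] by auto
qed

lemma metric_proj_obtuse:
  assumes "y \<in> A"
  shows "inner (x - metric_proj A x) (y - metric_proj A x) \<le> 0"
  using any_closest_point_dot[OF convex closed metric_proj_nearest(1) assms, where a = x]
    metric_proj_nearest(2)[of _ x] by (simp add: dist_norm)

lemma infdist_eq_metric_proj: "infdist x A = norm (x - metric_proj A x)"
proof (rule antisym)
  show "infdist x A \<le> norm (x - metric_proj A x)"
    using infdist_le[OF metric_proj_nearest(1)[of x], of x] by (simp add: dist_norm)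
  show "norm (x - metric_proj A x) \<le> infdist x A"
    unfolding infdist_notempty[OF nonempty]
    using metric_proj_nearest(2) by (intro cINF_greatest nonempty) (auto simp: dist_norm)
qed

text \<open>
  The angle at the projection is obtuse, so the law of cosines becomes the Pythagorean inequality.
\<close>

lemma metric_proj_pythagoras:
  assumes "y \<in> A"
  shows "(norm (y - metric_proj A x))\<^sup>2 + (norm (x - metric_proj A x))\<^sup>2 \<le> (norm (x - y))\<^sup>2"
  using metric_proj_obtuse[OF assms, of x] unfolding power2_norm_eq_inner
  by (simp add: inner_diff_left inner_diff_right inner_commute)

lemma metric_proj_nonexpansive:
  "norm (metric_proj A x - metric_proj A y) \<le> norm (x - y)"
proof -
  let ?a = "metric_proj A x" and ?b = "metric_proj A y"
  have "inner (x - ?a) (?b - ?a) \<le> 0" "inner (y - ?b) (?a - ?b) \<le> 0"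
    using metric_proj_obtuse metric_proj_nearest(1) by auto
  then have "(norm (?a - ?b))\<^sup>2 \<le> inner (x - y) (?a - ?b)"
    unfolding power2_norm_eq_inner
    by (simp add: inner_diff_left inner_diff_right inner_commute)
  also have "\<dots> \<le> norm (x - y) * norm (?a - ?b)"
    by (rule norm_cauchy_schwarz)
  finally show ?thesis
    by (cases "norm (?a - ?b) = 0") (auto simp: power2_eq_square)
qed

lemma tendsto_metric_proj:
  assumes "(f \<longlongrightarrow> x) G"
  shows "((\<lambda>i. metric_proj A (f i)) \<longlongrightarrow> metric_proj A x) G"
proof (rule metric_tendsto_imp_tendsto[OF assms])
  show "\<forall>\<^sub>F i in G. dist (metric_proj A (f i)) (metric_proj A x) \<le> dist (f i) x"
    by (simp add: dist_norm metric_proj_nonexpansive)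
qed

end

section \<open>Proximal pairs and alternating projections\<close>

definition proximal_pair :: "'a::real_normed_vector set \<Rightarrow> 'a set \<Rightarrow> 'a \<Rightarrow> 'a \<Rightarrow> bool" where
  "proximal_pair M N p q \<longleftrightarrow> p \<in> M \<and> q \<in> N \<and> norm (p - q) = setdist M N"

lemma proximal_pair_sym: "proximal_pair M N p q \<Longrightarrow> proximal_pair N M q p"
  by (simp add: proximal_pair_def setdist_sym norm_minus_commute)

lemma setdist_le_norm: "x \<in> M \<Longrightarrow> y \<in> N \<Longrightarrow> setdist M N \<le> norm (x - y)"
  using setdist_le_dist[of x M y N] by (simp add: dist_norm)

locale closed_convex_pair = M: closed_convex M + N: closed_convex N
  for M N :: "'a::{real_inner, complete_space} set"
begin

lemma swap: "closed_convex_pair N M"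
  by unfold_locales

lemma metric_proj_proximal:
  assumes "proximal_pair M N p q"
  shows "metric_proj M q = p" "metric_proj N p = q"
proof -
  show "metric_proj M q = p"
    using assms setdist_le_norm[of _ M q N]
    by (intro M.metric_proj_eqI) (auto simp: proximal_pair_def norm_minus_commute)
  show "metric_proj N p = q"
    using assms setdist_le_norm[of p M _ N]
    by (intro N.metric_proj_eqI) (auto simp: proximal_pair_def)
qed

text \<open>
  The differences \<open>x - y\<close> with \<open>x \<in> M\<close>, \<open>y \<in> N\<close> form a convex set, in which both displacements
  are nearest to the origin.
\<close>

lemma proximal_displacement_unique:
  assumes "proximal_pair M N p q" "proximal_pair M N p' q'"
  shows "p - q = p' - q'"
proof -
  define S where "S = (\<Union>x\<in>M. \<Union>y\<in>N. {x - y})"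
  have "convex S"
    unfolding S_def using convex_differences[OF M.convex N.convex] .
  moreover have "p - q \<in> S" "p' - q' \<in> S"
    using assms by (auto simp: S_def proximal_pair_def)
  moreover have "setdist M N \<le> norm (0 - s)" if "s \<in> S" for s
    using that setdist_le_norm by (fastforce simp: S_def norm_minus_commute)
  ultimately have "(norm ((p - q) - (p' - q')))\<^sup>2 \<le>
      2 * (norm (0 - (p - q)))\<^sup>2 + 2 * (norm (0 - (p' - q')))\<^sup>2 - 4 * (setdist M N)\<^sup>2"
    by (intro nearly_nearest_points_close[of S] setdist_pos_le) auto
  also have "\<dots> = 0"
    using assms by (simp add: proximal_pair_def norm_minus_commute)
  finally show ?thesis
    by simp
qed

lemma proximal_pair_convex_combination:
  assumes "proximal_pair M N p q" "proximal_pair M N p' q'" "0 \<le> t" "t \<le> 1"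
  shows "proximal_pair M N ((1 - t) *\<^sub>R p + t *\<^sub>R p') ((1 - t) *\<^sub>R q + t *\<^sub>R q')"
proof -
  have "(1 - t) *\<^sub>R p + t *\<^sub>R p' - ((1 - t) *\<^sub>R q + t *\<^sub>R q') = (1 - t) *\<^sub>R (p - q) + t *\<^sub>R (p' - q')"
    by (simp add: algebra_simps)
  also have "\<dots> = p - q"
    unfolding proximal_displacement_unique[OF assms(1,2)]
    by (simp flip: scaleR_left_distrib)
  finally show ?thesis
    using assms M.convex N.convex by (simp add: proximal_pair_def convexD)
qed

text \<open>
  Since \<open>p\<close> is the projection of \<open>q\<close>, the Pythagorean inequality reads
  \<open>\<parallel>x - p\<parallel>\<^sup>2 \<le> \<parallel>q - x\<parallel>\<^sup>2 - d\<^sup>2\<close>: near-optimal partners of \<open>q\<close> are close to the optimal one.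
\<close>

lemma tendsto_proximal_partner:
  assumes "proximal_pair M N p q" "\<And>i. x i \<in> M"
    and lim: "((\<lambda>i. norm (x i - q)) \<longlongrightarrow> setdist M N) G"
  shows "(x \<longlongrightarrow> p) G"
proof -
  have "((\<lambda>i. (norm (x i - p))\<^sup>2) \<longlongrightarrow> 0) G"
  proof (rule tendsto_sandwich[of "\<lambda>_. 0"])
    show "\<forall>\<^sub>F i in G. (norm (x i - p))\<^sup>2 \<le> (norm (x i - q))\<^sup>2 - (setdist M N)\<^sup>2"
    proof (rule always_eventually, rule allI)
      fix i
      show "(norm (x i - p))\<^sup>2 \<le> (norm (x i - q))\<^sup>2 - (setdist M N)\<^sup>2"
        using M.metric_proj_pythagoras[OF assms(2), of i q] metric_proj_proximal(1)[OF assms(1)]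
          assms(1) by (simp add: proximal_pair_def norm_minus_commute)
    qed
    show "((\<lambda>i. (norm (x i - q))\<^sup>2 - (setdist M N)\<^sup>2) \<longlongrightarrow> 0) G"
      using tendsto_diff[OF tendsto_power[OF lim, of 2] tendsto_const[of "(setdist M N)\<^sup>2"]]
      by simp
  qed auto
  then have "((\<lambda>i. norm (x i - p)) \<longlongrightarrow> 0) G"
    using tendsto_real_sqrt by fastforce
  then show ?thesis
    by (simp add: tendsto_norm_zero_iff LIM_zero_iff)
qed

text \<open>
  With \<open>v = p - q\<close>, \<open>m = P\<^sub>M u - p\<close> and \<open>s = P\<^sub>M u - u\<close>, the right side exceeds the left side by
  \<open>- 2 \<langle>s, m\<rangle> - 2 \<langle>v, u - q\<rangle>\<close>. Both terms are nonnegative, because \<open>P\<^sub>M u\<close> is nearest to \<open>u\<close>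
  in \<open>M\<close> and \<open>q\<close> is nearest to \<open>p\<close> in \<open>N\<close>.
\<close>

lemma metric_proj_across_gap:
  assumes "proximal_pair M N p q" "u \<in> N"
  shows "(norm (metric_proj M u - q))\<^sup>2 + (norm ((metric_proj M u - u) - (p - q)))\<^sup>2
      \<le> (norm (u - p))\<^sup>2"
proof -
  let ?a = "metric_proj M u"
  have "inner (u - ?a) (p - ?a) \<le> 0"
    using M.metric_proj_obtuse assms(1) by (simp add: proximal_pair_def)
  moreover have "inner (p - q) (u - q) \<le> 0"
    using N.metric_proj_obtuse[OF assms(2), of p] metric_proj_proximal(2)[OF assms(1)] by simp
  moreover have "(norm (u - p))\<^sup>2 - (norm (?a - q))\<^sup>2 - (norm ((?a - u) - (p - q)))\<^sup>2
      = - 2 * inner (u - ?a) (p - ?a) - 2 * inner (p - q) (u - q)"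
    unfolding power2_norm_eq_inner
    by (simp add: inner_diff_left inner_diff_right inner_commute algebra_simps)
  ultimately show ?thesis
    by linarith
qed

lemma metric_proj_across_gap_le:
  assumes "proximal_pair M N p q" "u \<in> N"
  shows "norm (metric_proj M u - q) \<le> norm (u - p)"
proof -
  have "(norm (metric_proj M u - q))\<^sup>2 \<le> (norm (u - p))\<^sup>2"
    using metric_proj_across_gap[OF assms] zero_le_power2[of "norm ((metric_proj M u - u) - (p - q))"]
    by linarith
  then show ?thesis
    by (rule power2_le_imp_le) simp
qed

lemma setdist_le_infdist: "x \<in> M \<Longrightarrow> setdist M N \<le> infdist x N"
  unfolding N.infdist_eq_metric_proj by (simp add: setdist_le_norm N.metric_proj_nearest(1))

lemma alt_proj_in: "x \<in> M \<Longrightarrow> (alt_proj M N ^^ n) x \<in> M"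
  by (cases n) (auto simp: alt_proj_def M.metric_proj_nearest(1))

lemma alt_proj_step:
  assumes "proximal_pair M N p q" "x \<in> M"
  shows "(norm (alt_proj M N x - q))\<^sup>2 + (infdist (alt_proj M N x) N - setdist M N)\<^sup>2
      \<le> (norm (x - q))\<^sup>2"
    and "infdist (alt_proj M N x) N \<le> infdist x N"
proof -
  interpret swapped: closed_convex_pair N M
    by (rule swap)
  let ?u = "metric_proj N x" and ?a = "alt_proj M N x"
  have "?u \<in> N" "?a \<in> M"
    by (auto simp: alt_proj_def M.metric_proj_nearest(1) N.metric_proj_nearest(1))
  have "infdist ?a N \<le> norm (?a - ?u)"
    using infdist_le[OF \<open>?u \<in> N\<close>, of ?a] by (simp add: dist_norm)
  also have "\<dots> \<le> norm (x - ?u)"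
    unfolding alt_proj_def using M.metric_proj_nearest(2)[OF assms(2), of ?u]
    by (simp add: norm_minus_commute)
  finally show "infdist ?a N \<le> infdist x N"
    by (simp add: N.infdist_eq_metric_proj)
  have "infdist ?a N - setdist M N \<le> norm (?a - ?u) - norm (p - q)"
    using \<open>infdist ?a N \<le> norm (?a - ?u)\<close> assms(1) by (simp add: proximal_pair_def)
  also have "\<dots> \<le> norm ((?a - ?u) - (p - q))"
    by (rule norm_triangle_ineq2)
  finally have "(infdist ?a N - setdist M N)\<^sup>2 \<le> (norm ((?a - ?u) - (p - q)))\<^sup>2"
    using setdist_le_infdist[OF \<open>?a \<in> M\<close>] by (intro power_mono) auto
  moreover have "(norm (?u - p))\<^sup>2 \<le> (norm (x - q))\<^sup>2"
    using swapped.metric_proj_across_gap_le[OF proximal_pair_sym[OF assms(1)] assms(2)]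
    by (intro power_mono) auto
  moreover have "(norm (?a - q))\<^sup>2 + (norm ((?a - ?u) - (p - q)))\<^sup>2 \<le> (norm (?u - p))\<^sup>2"
    using metric_proj_across_gap[OF assms(1) \<open>?u \<in> N\<close>] by (simp add: alt_proj_def)
  ultimately show "(norm (?a - q))\<^sup>2 + (infdist ?a N - setdist M N)\<^sup>2 \<le> (norm (x - q))\<^sup>2"
    by linarith
qed

text \<open>
  The excess gaps along the orbit are decreasing, so \<open>n\<close> times the square of the last one is at
  most the sum of all the squares, which telescopes.
\<close>

lemma alt_proj_gap_rate:
  assumes "proximal_pair M N p q" "x \<in> M"
  shows "(norm ((alt_proj M N ^^ n) x - q))\<^sup>2
      + real n * (infdist ((alt_proj M N ^^ n) x) N - setdist M N)\<^sup>2 \<le> (norm (x - q))\<^sup>2"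
proof (induction n)
  case 0
  show ?case
    by simp
next
  case (Suc n)
  let ?x = "(alt_proj M N ^^ n) x"
  note step = alt_proj_step[OF assms(1) alt_proj_in[OF assms(2), of n]]
  have "alt_proj M N ?x \<in> M"
    using alt_proj_in[OF assms(2), of "Suc n"] by simp
  then have "(infdist (alt_proj M N ?x) N - setdist M N)\<^sup>2 \<le> (infdist ?x N - setdist M N)\<^sup>2"
    using step(2) setdist_le_infdist by (intro power_mono) auto
  then have "real n * (infdist (alt_proj M N ?x) N - setdist M N)\<^sup>2
      \<le> real n * (infdist ?x N - setdist M N)\<^sup>2"
    by (rule mult_left_mono) simp
  then show ?case
    using step(1) Suc.IH unfolding of_nat_Suc distrib_right funpow.simps o_apply by linarith
qed

lemma alt_proj_le:
  assumes "proximal_pair M N p q" "x \<in> M"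
  shows "norm ((alt_proj M N ^^ n) x - q) \<le> norm (x - q)"
proof -
  have "0 \<le> real n * (infdist ((alt_proj M N ^^ n) x) N - setdist M N)\<^sup>2"
    by simp
  then have "(norm ((alt_proj M N ^^ n) x - q))\<^sup>2 \<le> (norm (x - q))\<^sup>2"
    using alt_proj_gap_rate[OF assms, of n] by linarith
  then show ?thesis
    by (rule power2_le_imp_le) simp
qed

lemma alt_proj_gap_tendsto:
  assumes "proximal_pair M N p q" "bounded M" "\<And>n. x n \<in> M"
  shows "(\<lambda>n. infdist ((alt_proj M N ^^ n) (x n)) N) \<longlonglongrightarrow> setdist M N"
proof -
  let ?g = "\<lambda>n. infdist ((alt_proj M N ^^ n) (x n)) N - setdist M N"
  obtain B where B: "\<And>y. y \<in> M \<Longrightarrow> norm (y - q) \<le> B"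
    using \<open>bounded M\<close> unfolding bounded_any_center[where a = q]
    by (auto simp: dist_norm norm_minus_commute)
  have "(\<lambda>n. (?g n)\<^sup>2) \<longlonglongrightarrow> 0"
  proof (rule tendsto_sandwich[of "\<lambda>_. 0"])
    show "\<forall>\<^sub>F n in sequentially. (?g n)\<^sup>2 \<le> B\<^sup>2 / real n"
    proof (rule eventually_mono[OF eventually_gt_at_top[of 0]])
      fix n :: nat assume "0 < n"
      have "real n * (?g n)\<^sup>2 \<le> (norm (x n - q))\<^sup>2"
        using alt_proj_gap_rate[OF assms(1,3)] zero_le_power2 by (smt (verit))
      also have "\<dots> \<le> B\<^sup>2"
        using B assms(3) by (intro power_mono) auto
      finally show "(?g n)\<^sup>2 \<le> B\<^sup>2 / real n"
        using \<open>0 < n\<close> by (simp add: field_simps)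
    qed
    show "(\<lambda>n. B\<^sup>2 / real n) \<longlonglongrightarrow> 0"
      by (rule lim_const_over_n)
  qed auto
  then have "(\<lambda>n. \<bar>?g n\<bar>) \<longlonglongrightarrow> 0"
    using tendsto_real_sqrt by fastforce
  then show ?thesis
    by (simp add: tendsto_rabs_zero_iff LIM_zero_iff)
qed

end

section \<open>Cyclic relatively nonexpansive maps\<close>

locale cyclic_relatively_nonexpansive = closed_convex_pair M N
  for M N :: "'a::{real_inner, complete_space} set" +
  fixes F :: "'a \<Rightarrow> 'a"
  assumes F_M: "x \<in> M \<Longrightarrow> F x \<in> N" and F_N: "y \<in> N \<Longrightarrow> F y \<in> M"
    and relatively_nonexpansive: "x \<in> M \<Longrightarrow> y \<in> N \<Longrightarrow> norm (F x - F y) \<le> norm (x - y)"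
begin

lemma proximal_pair_image:
  assumes "proximal_pair M N p q"
  shows "proximal_pair M N (F q) (F p)"
  using assms F_M F_N relatively_nonexpansive[of p q] setdist_le_norm[of "F q" M "F p" N]
  by (auto simp: proximal_pair_def norm_minus_commute)

lemma metric_proj_image_across_gap_le:
  assumes "proximal_pair M N p q" "F q = p" "x \<in> M"
  shows "norm (metric_proj M (F x) - q) \<le> norm (x - q)"
proof -
  have "norm (metric_proj M (F x) - q) \<le> norm (F x - p)"
    by (rule metric_proj_across_gap_le[OF assms(1) F_M[OF assms(3)]])
  also have "\<dots> \<le> norm (x - q)"
    using relatively_nonexpansive[of x q] assms by (auto simp: proximal_pair_def)
  finally show ?thesis .
qed

lemma tendsto_image_at_proximal:
  assumes "proximal_pair M N p q" "\<And>i. x i \<in> M" "(x \<longlongrightarrow> p) G"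
  shows "((\<lambda>i. F (x i)) \<longlongrightarrow> F p) G"
proof -
  interpret swapped: closed_convex_pair N M
    by (rule swap)
  have q: "q \<in> N"
    using assms(1) by (simp add: proximal_pair_def)
  have pair: "proximal_pair N M (F p) (F q)"
    using proximal_pair_sym[OF proximal_pair_image[OF assms(1)]] .
  have "((\<lambda>i. norm (F (x i) - F q)) \<longlongrightarrow> setdist N M) G"
  proof (rule tendsto_sandwich)
    show "\<forall>\<^sub>F i in G. setdist N M \<le> norm (F (x i) - F q)"
      using F_M F_N q assms(2) by (intro always_eventually allI setdist_le_norm) auto
    show "\<forall>\<^sub>F i in G. norm (F (x i) - F q) \<le> norm (x i - q)"
      using relatively_nonexpansive q assms(2) by (intro always_eventually allI) auto
    have "((\<lambda>i. norm (x i - q)) \<longlongrightarrow> norm (p - q)) G"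
      by (intro tendsto_intros assms(3))
    then show "((\<lambda>i. norm (x i - q)) \<longlongrightarrow> setdist N M) G"
      using assms(1) by (simp add: proximal_pair_def setdist_sym)
  qed auto
  then show ?thesis
    using F_M assms(2) by (intro swapped.tendsto_proximal_partner[OF pair]) auto
qed

text \<open>
  The two relative estimates across the gap, from \<open>p\<close> to \<open>q'\<close> and from \<open>p'\<close> to \<open>q\<close>, concern
  the vectors \<open>v \<plusminus> (p - p')\<close> for the common displacement \<open>v\<close>. By the parallelogram law
  \<open>v\<close> cancels when their squares are added.
\<close>

lemma nonexpansive_on_proximal_pairs:
  assumes "proximal_pair M N p q" "proximal_pair M N p' q'"
  shows "norm (F q - F q') \<le> norm (p - p')"
proof -
  define v where "v = p - q"
  have parallelogram: "(norm (a + v))\<^sup>2 + (norm (v - a))\<^sup>2 = 2 * (norm a)\<^sup>2 + 2 * (norm v)\<^sup>2" for a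
    unfolding power2_norm_eq_inner
    by (simp add: inner_diff_left inner_diff_right inner_add_left inner_add_right inner_commute)
  note displacement = proximal_displacement_unique[OF _ assms(1), folded v_def]
  have q: "q = p - v" "q' = p' - v"
    using displacement[OF assms(2)] by (auto simp: v_def algebra_simps)
  have Fq: "F p = F q - v" "F p' = F q' - v"
    using displacement[OF proximal_pair_image] assms by (auto simp: algebra_simps)
  have "norm (F p - F q') \<le> norm (p - q')" "norm (F p' - F q) \<le> norm (p' - q)"
    using assms relatively_nonexpansive by (auto simp: proximal_pair_def)
  moreover have "F p - F q' = - (v - (F q - F q'))" "F p' - F q = - ((F q - F q') + v)"
    "p - q' = (p - p') + v" "p' - q = v - (p - p')"
    by (auto simp: Fq q)
  ultimately have "norm (v - (F q - F q')) \<le> norm ((p - p') + v)"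
    "norm ((F q - F q') + v) \<le> norm (v - (p - p'))"
    by (metis norm_minus_cancel)+
  then have "(norm (v - (F q - F q')))\<^sup>2 \<le> (norm ((p - p') + v))\<^sup>2"
    "(norm ((F q - F q') + v))\<^sup>2 \<le> (norm (v - (p - p')))\<^sup>2"
    by (auto intro: power_mono)
  then have "(norm (F q - F q'))\<^sup>2 \<le> (norm (p - p'))\<^sup>2"
    using parallelogram[of "F q - F q'"] parallelogram[of "p - p'"] by linarith
  then show ?thesis
    by (rule power2_le_imp_le) simp
qed

text \<open>
  \<open>F\<close> turns a minimizing sequence of pairs into another one, half of which lies in the compact
  set; this replaces the weak compactness of bounded closed convex sets.
\<close>

lemma proximal_pair_exists:
  assumes "compact K" "K \<subseteq> N" "F ` M \<subseteq> K"
  shows "\<exists>p q. proximal_pair M N p q"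
proof -
  have "\<exists>x\<in>M. \<exists>y\<in>N. norm (x - y) < setdist M N + 1 / real (Suc n)" for n
  proof (rule ccontr)
    assume "\<not> ?thesis"
    then have "setdist M N + 1 / real (Suc n) \<le> setdist M N"
      using M.nonempty N.nonempty by (intro le_setdistI) (auto simp: dist_norm not_less)
    then show False
      by (simp add: not_le)
  qed
  then obtain x y where xy: "\<And>n. x n \<in> M" "\<And>n. y n \<in> N"
    "\<And>n. norm (x n - y n) < setdist M N + 1 / real (Suc n)"
    by metis
  have "\<forall>n. F (x n) \<in> K"
    using xy(1) assms(3) by blast
  then obtain k r where k: "k \<in> K" "strict_mono (r :: nat \<Rightarrow> nat)" "(\<lambda>n. F (x (r n))) \<longlonglongrightarrow> k"
    using seq_compactE[OF compact_imp_seq_compact[OF \<open>compact K\<close>], of "\<lambda>n. F (x n)"]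
    by (auto simp: o_def)
  have "norm (k - metric_proj M k)
      \<le> norm (k - F (x (r n))) + (setdist M N + 1 / real (Suc (r n)))" for n
  proof -
    have "norm (k - metric_proj M k) \<le> norm (k - F (y (r n)))"
      using M.metric_proj_nearest(2) F_N xy(2) by blast
    also have "\<dots> \<le> norm (k - F (x (r n))) + norm (F (x (r n)) - F (y (r n)))"
      using norm_triangle_ineq[of "k - F (x (r n))" "F (x (r n)) - F (y (r n))"] by simp
    finally show ?thesis
      using relatively_nonexpansive[OF xy(1,2), of "r n" "r n"] xy(3)[of "r n"] by linarith
  qed
  moreover have "(\<lambda>n. norm (k - F (x (r n))) + (setdist M N + 1 / real (Suc (r n))))
      \<longlonglongrightarrow> norm (k - k) + (setdist M N + 0)"
    by (intro tendsto_intros k(3) LIMSEQ_subseq_LIMSEQ[OF _ k(2), unfolded o_def]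
        LIMSEQ_Suc[OF lim_1_over_n])
  ultimately have "norm (k - metric_proj M k) \<le> setdist M N"
    using Lim_bounded2[of _ _ 0] by fastforce
  then have "proximal_pair M N (metric_proj M k) k"
    using setdist_le_norm[of "metric_proj M k" M k N] M.metric_proj_nearest(1)[of k] k(1) assms(2)
    by (auto simp: proximal_pair_def norm_minus_commute)
  then show ?thesis
    by blast
qed

end

section \<open>Convergence of the projected Ishikawa iteration\<close>

theorem corollary2p6:
  fixes M N :: "'a::{real_inner, complete_space} set"
    and F :: "'a \<Rightarrow> 'a"
    and \<epsilon> :: real
    and \<eta> \<delta> :: "nat \<Rightarrow> real"
    and w z :: "nat \<Rightarrow> 'a"
  assumes "M \<noteq> {}" "closed M" "bounded M" "convex M"
    and "N \<noteq> {}" "closed N" "bounded N" "convex N"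
    and "F ` (M \<union> N) \<subseteq> M \<union> N"
    and "F ` M \<subseteq> N" "F ` N \<subseteq> M"
    and "\<And>x y. x \<in> M \<Longrightarrow> y \<in> N \<Longrightarrow> norm (F x - F y) \<le> norm (x - y)"
    and "0 < \<epsilon>" "\<epsilon> < 1 / 2"
    and "\<And>n. \<eta> n \<in> {\<epsilon><..<1 - \<epsilon>}"
    and "\<And>n. \<delta> n \<in> {\<epsilon><..<1 - \<epsilon>}"
    and "w 0 \<in> M"
    and "\<And>n. z n = (1 - \<delta> n) *\<^sub>R w n + \<delta> n *\<^sub>R metric_proj M (F (w n))"
    and "\<And>n. w (Suc n) =
           (alt_proj M N ^^ n) ((1 - \<eta> n) *\<^sub>R w n + \<eta> n *\<^sub>R metric_proj M (F (z n)))"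
    and "\<exists>K. compact K \<and> K \<subseteq> N \<and> F ` M \<subseteq> K"
    and "(\<lambda>n. norm (w n - metric_proj M (F (z n)))) \<longlonglongrightarrow> 0"
  shows "\<exists>w'\<in>proximal_part M N. w \<longlonglongrightarrow> w' \<and> norm (w' - F w') = setdist M N"
proof -
  interpret cyclic_relatively_nonexpansive M N F
    using assms(1-12) by unfold_locales auto
  let ?P = "metric_proj M"
  let ?d = "setdist M N"
  have \<eta>: "0 \<le> \<eta> n" "\<eta> n \<le> 1" and \<delta>: "\<delta> n \<in> {\<epsilon>..1 - \<epsilon>}" "0 \<le> \<delta> n" "\<delta> n \<le> 1" for n
    using assms(13) assms(15)[of n] assms(16)[of n] by auto
  have mixture_in_M: "(1 - t) *\<^sub>R x + t *\<^sub>R y \<in> M" if "x \<in> M" "y \<in> M" "0 \<le> t" "t \<le> 1" for x y t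
    using convexD[OF \<open>convex M\<close>] that by simp
  have w: "w n \<in> M" for n
  proof (induction n)
    case (Suc n)
    show ?case
      unfolding assms(19)
      by (intro alt_proj_in mixture_in_M Suc M.metric_proj_nearest(1) \<eta>)
  qed (rule assms(17))
  have z: "z n \<in> M" for n
    unfolding assms(18) by (intro mixture_in_M w M.metric_proj_nearest(1) \<delta>)
  obtain K where K: "compact K" "K \<subseteq> N" "F ` M \<subseteq> K"
    using assms(20) by blast
  obtain p0 q0 where "proximal_pair M N p0 q0"
    using proximal_pair_exists[OF K] by blast
  then have "(\<lambda>n. infdist (w (Suc n)) N) \<longlonglongrightarrow> ?d"
    unfolding assms(19)
    by (intro alt_proj_gap_tendsto \<open>bounded M\<close> mixture_in_M w M.metric_proj_nearest(1) \<eta>)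
  then have gap: "(\<lambda>n. infdist (w n) N) \<longlonglongrightarrow> ?d"
    by (rule LIMSEQ_imp_Suc)

  \<comment> \<open>A common subsequence for the images \<open>F z\<^sub>n\<close> and the parameters \<open>\<delta>\<^sub>n\<close>.\<close>
  have parameters: "compact (K \<times> {\<epsilon>..1 - \<epsilon>})"
    by (intro compact_Times \<open>compact K\<close> compact_Icc)
  have "\<forall>n. (F (z n), \<delta> n) \<in> K \<times> {\<epsilon>..1 - \<epsilon>}"
    using z K(3) \<delta>(1) by blast
  then obtain l r where l: "l \<in> K \<times> {\<epsilon>..1 - \<epsilon>}" and r: "strict_mono (r :: nat \<Rightarrow> nat)"
    and lim_l: "(\<lambda>n. (F (z (r n)), \<delta> (r n))) \<longlonglongrightarrow> l"
    using seq_compactE[OF compact_imp_seq_compact[OF parameters], of "\<lambda>n. (F (z n), \<delta> n)"]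
    unfolding o_def by metis
  obtain k t where "l = (k, t)"
    by (cases l)
  then have t: "0 \<le> t" "t < 1"
    and lim_Fz: "(\<lambda>n. F (z (r n))) \<longlonglongrightarrow> k" and lim_\<delta>: "(\<lambda>n. \<delta> (r n)) \<longlonglongrightarrow> t"
    using l assms(13) tendsto_fst[OF lim_l] tendsto_snd[OF lim_l] by auto
  define p where "p = ?P k"
  define q where "q = metric_proj N p"
  have "(\<lambda>n. w n - ?P (F (z n))) \<longlonglongrightarrow> 0"
    using assms(21) by (simp add: tendsto_norm_zero_iff)
  then have "(\<lambda>n. (w (r n) - ?P (F (z (r n)))) + ?P (F (z (r n)))) \<longlonglongrightarrow> 0 + p"
    unfolding p_def using LIMSEQ_subseq_LIMSEQ[OF _ r] lim_Fz
    by (intro tendsto_add M.tendsto_metric_proj) (auto simp: o_def)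
  then have lim_w: "(\<lambda>n. w (r n)) \<longlonglongrightarrow> p"
    by simp
  have "(\<lambda>n. infdist (w (r n)) N) \<longlonglongrightarrow> infdist p N"
    by (intro tendsto_infdist lim_w)
  then have "infdist p N = ?d"
    using LIMSEQ_subseq_LIMSEQ[OF gap r] LIMSEQ_unique by (auto simp: o_def)
  then have pq: "proximal_pair M N p q"
    unfolding proximal_pair_def q_def p_def N.infdist_eq_metric_proj
    by (simp add: M.metric_proj_nearest(1) N.metric_proj_nearest(1))

  \<comment> \<open>The pair \<open>(\<zeta>, \<zeta>')\<close> is the limit of the \<open>z\<^sub>n\<close> together with its partner.\<close>
  define \<zeta> where "\<zeta> = (1 - t) *\<^sub>R p + t *\<^sub>R F q"
  define \<zeta>' where "\<zeta>' = (1 - t) *\<^sub>R q + t *\<^sub>R F p"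
  have Fpq: "proximal_pair M N (F q) (F p)"
    by (rule proximal_pair_image[OF pq])
  have \<zeta>: "proximal_pair M N \<zeta> \<zeta>'"
    unfolding \<zeta>_def \<zeta>'_def using t by (intro proximal_pair_convex_combination pq Fpq) auto
  have "(\<lambda>n. ?P (F (w (r n)))) \<longlonglongrightarrow> ?P (F p)"
    by (intro M.tendsto_metric_proj tendsto_image_at_proximal[OF pq] w lim_w)
  then have "(\<lambda>n. z (r n)) \<longlonglongrightarrow> \<zeta>"
    unfolding assms(18) \<zeta>_def metric_proj_proximal(1)[OF Fpq]
    by (intro tendsto_intros lim_\<delta> lim_w)
  then have "(\<lambda>n. F (z (r n))) \<longlonglongrightarrow> F \<zeta>"
    by (intro tendsto_image_at_proximal[OF \<zeta>] z)
  then have "k = F \<zeta>"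
    using lim_Fz LIMSEQ_unique by blast
  then have "p = F \<zeta>'"
    using metric_proj_proximal(1)[OF proximal_pair_image[OF \<zeta>]] by (simp add: p_def)
  then have "norm (p - F q) \<le> norm (\<zeta> - p)"
    using nonexpansive_on_proximal_pairs[OF \<zeta> pq] by simp
  also have "\<zeta> - p = t *\<^sub>R (F q - p)"
    by (simp add: \<zeta>_def algebra_simps)
  also have "norm \<dots> = t * norm (p - F q)"
    using t by (simp add: norm_minus_commute)
  finally have "(1 - t) * norm (p - F q) \<le> 0"
    by (simp add: algebra_simps)
  then have "F q = p"
    using t by (simp add: mult_le_0_iff)

  have mixture_le: "norm (((1 - s) *\<^sub>R x + s *\<^sub>R y) - q) \<le> B"
    if "norm (x - q) \<le> B" "norm (y - q) \<le> B" "0 \<le> s" "s \<le> 1" for x y s B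
    using convexD[OF convex_cball[of q B], of x y "1 - s" s] that
    by (simp add: dist_norm norm_minus_commute)
  have z_le: "norm (z n - q) \<le> norm (w n - q)" for n
    unfolding assms(18)
    by (intro mixture_le metric_proj_image_across_gap_le[OF pq \<open>F q = p\<close>] w \<delta> order_refl)
  have "norm (w (Suc n) - q) \<le> norm (w n - q)" for n
  proof -
    have "norm (?P (F (z n)) - q) \<le> norm (w n - q)"
      using metric_proj_image_across_gap_le[OF pq \<open>F q = p\<close> z] z_le order_trans by blast
    then have "norm (((1 - \<eta> n) *\<^sub>R w n + \<eta> n *\<^sub>R ?P (F (z n))) - q) \<le> norm (w n - q)"
      by (intro mixture_le \<eta> order_refl)
    moreover have "norm (w (Suc n) - q)
        \<le> norm (((1 - \<eta> n) *\<^sub>R w n + \<eta> n *\<^sub>R ?P (F (z n))) - q)"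
      unfolding assms(19) by (intro alt_proj_le[OF pq] mixture_in_M w M.metric_proj_nearest(1) \<eta>)
    ultimately show ?thesis
      by linarith
  qed
  then have "decseq (\<lambda>n. norm (w n - q))"
    by (rule decseq_SucI)
  then obtain L where L: "(\<lambda>n. norm (w n - q)) \<longlonglongrightarrow> L"
    using decseq_convergent[of _ 0] by (metis norm_ge_zero)
  have "(\<lambda>n. norm (w (r n) - q)) \<longlonglongrightarrow> norm (p - q)"
    by (intro tendsto_intros lim_w)
  then have "L = ?d"
    using LIMSEQ_subseq_LIMSEQ[OF L r] pq LIMSEQ_unique
    by (fastforce simp: o_def proximal_pair_def)
  then have "w \<longlonglongrightarrow> p"
    using L by (intro tendsto_proximal_partner[OF pq w]) simp
  moreover have "p \<in> proximal_part M N" "norm (p - F p) = ?d"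
    using pq Fpq \<open>F q = p\<close> by (auto simp: proximal_part_def proximal_pair_def)
  ultimately show ?thesis
    by blast
qed

end
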